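(* Let $N\ge 2$, $1 \leq p \leq N$ and let $\Omega \subseteq \mathbb{R}^N$ be an open set. For every standard body $\mathcal{K} \subseteq \mathbb{R}^N$, there exist two constants $0 < c \leq 1\le d$, both depending only on $N$, $p$ and $\mathcal{K}$ (and not on $\Omega$), such that \[ R_{p, c\cdot\gamma}(\Omega; \mathcal{K}) \leq R_{p, \gamma}(\Omega), \qquad\text{for every}\ 0<\gamma<1, \] and \[ R_{p, \gamma}(\Omega) \leq R_\mathcal{K}\,R_{p, d\cdot\gamma}(\Omega; \mathcal{K}),\qquad\text{for every}\ 0<\gamma<\frac{1}{d}, \] where $R_\mathcal{K} = \max_{x \in \partial \mathcal{K}} |x|$.
   Context: $B_r(x)$ is the open Euclidean ball in $\mathbb{R}^N$ of center $x$ and radius $r$, and $B_1$ is the unit ball centered at the origin. $C^\infty_0(E)$ is the space of smooth functions with compact support in $E$. Suprema of sets of positive numbers are taken in $[0,+\infty]$. Relative $p$-capacity: for $E\subseteq \mathbb{R}^N$ open and $\Sigma\subseteq E$ compact, $\mathrm{cap}_p(\Sigma;E)=\inf\{\int_E |\nabla \varphi|^p\,dx : \varphi\in C^\infty_0(E),\ \varphi \ge 1 \text{ on } \Sigma\}$. Standard body: an open bounded set $\mathcal{K}\subseteq\mathbb{R}^N$ which is starshaped with respect to the ball $B_1$ (i.e. with respect to every point of $B_1$; in particular $B_1\subseteq\mathcal{K}$). For $r>0$ and $x_0\in\mathbb{R}^N$, $\mathcal{K}_r(x_0)=\{x\in\mathbb{R}^N : (x-x_0)/r\in\mathcal{K}\}$.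 Capacitary inradius relative to $\mathcal{K}$: for $0<\gamma<1$, \[ R_{p,\gamma}(\Omega;\mathcal{K})=\sup\Big\{r>0 : \exists x_0\in\mathbb{R}^N \text{ such that } \mathrm{cap}_p\big(\overline{\mathcal{K}_r(x_0)}\setminus\Omega;\mathcal{K}_{2r}(x_0)\big)\le \gamma\,\mathrm{cap}_p\big(\overline{\mathcal{K}_r(x_0)};\mathcal{K}_{2r}(x_0)\big)\Big\}. \] Capacitary inradius: $R_{p,\gamma}(\Omega)$ is the same quantity for $\mathcal{K}=B_1$, i.e. \[ R_{p,\gamma}(\Omega)=\sup\Big\{r>0 : \exists x_0\in\mathbb{R}^N \text{ such that } \mathrm{cap}_p\big(\overline{B_r(x_0)}\setminus\Omega;B_{2r}(x_0)\big)\le \gamma\,\mathrm{cap}_p\big(\overline{B_r(x_0)};B_{2r}(x_0)\big)\Big\}. \] *)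

theory Defs
  imports "HOL-Analysis.Analysis"
begin

subsection \<open>Test functions and gradient\<close>

primrec Ck :: "nat \<Rightarrow> ('a::euclidean_space \<Rightarrow> real) \<Rightarrow> bool" where
  "Ck 0 f \<longleftrightarrow> continuous_on UNIV f"
| "Ck (Suc k) f \<longleftrightarrow> f differentiable_on UNIV \<and>
     (\<forall>i\<in>Basis. Ck k (\<lambda>x. frechet_derivative f (at x) i))"

definition smooth :: "('a::euclidean_space \<Rightarrow> real) \<Rightarrow> bool" where
  "smooth f \<longleftrightarrow> (\<forall>k. Ck k f)"

text \<open>A function in \<open>C\<^sub>0\<^sup>\<infinity>(E)\<close>, with \<open>E\<close> open, is identified with its extension by zero,
  which is smooth on the whole space.\<close>

definition test_functions :: "'a::euclidean_space set \<Rightarrow> ('a \<Rightarrow> real) set" where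
  "test_functions E =
     {\<phi>. smooth \<phi> \<and> compact (closure {x. \<phi> x \<noteq> 0}) \<and> closure {x. \<phi> x \<noteq> 0} \<subseteq> E}"

definition grad :: "('a::euclidean_space \<Rightarrow> real) \<Rightarrow> 'a \<Rightarrow> 'a" where
  "grad f x = (\<Sum>i\<in>Basis. frechet_derivative f (at x) i *\<^sub>R i)"

lemma GDERIV_grad:
  fixes f :: "'a::euclidean_space \<Rightarrow> real"
  assumes "f differentiable (at x)"
  shows "GDERIV f x :> grad f x"
proof -
  let ?D = "frechet_derivative f (at x)"
  have D: "(f has_derivative ?D) (at x)"
    using assms frechet_derivative_works by blast
  then have lin: "linear ?D"
    by (rule has_derivative_linear)
  have "?D h = h \<bullet> grad f x" for h
  proof -
    have "?D h = ?D (\<Sum>i\<in>Basis. (h \<bullet> i) *\<^sub>R i)"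
      by (simp add: euclidean_representation)
    also have "\<dots> = (\<Sum>i\<in>Basis. (h \<bullet> i) * ?D i)"
      using lin by (simp add: linear_sum linear_scale)
    also have "\<dots> = h \<bullet> grad f x"
      by (simp add: grad_def inner_sum_right mult.commute)
    finally show ?thesis .
  qed
  then have "?D = (\<lambda>h. h \<bullet> grad f x)" by blast
  with D show ?thesis
    by (simp add: gderiv_def)
qed


subsection \<open>Relative capacity\<close>

definition rel_cap :: "real \<Rightarrow> 'a::euclidean_space set \<Rightarrow> 'a set \<Rightarrow> ennreal" where
  "rel_cap p \<Sigma> E =
     (INF \<phi> \<in> {\<phi> \<in> test_functions E. \<forall>x\<in>\<Sigma>. 1 \<le> \<phi> x}.
        \<integral>\<^sup>+x\<in>E. ennreal (norm (grad \<phi> x) powr p) \<partial>lborel)"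


subsection \<open>Standard bodies\<close>

definition starshaped_wrt :: "'a::real_vector \<Rightarrow> 'a set \<Rightarrow> bool" where
  "starshaped_wrt a S \<longleftrightarrow> a \<in> S \<and> (\<forall>x\<in>S. closed_segment a x \<subseteq> S)"

definition standard_body :: "'a::euclidean_space set \<Rightarrow> bool" where
  "standard_body K \<longleftrightarrow> open K \<and> bounded K \<and> (\<forall>a\<in>ball 0 1. starshaped_wrt a K)"

definition scaled_body :: "'a::euclidean_space set \<Rightarrow> real \<Rightarrow> 'a \<Rightarrow> 'a set" where
  "scaled_body K r x0 = {x. (x - x0) /\<^sub>R r \<in> K}"

lemma scaled_body_ball:
  assumes "r > 0"
  shows "scaled_body (ball 0 1) r x0 = ball x0 r"
proof -
  have "norm ((x - x0) /\<^sub>R r) < 1 \<longleftrightarrow> norm (x0 - x) < r" for x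
    unfolding norm_scaleR using assms by (simp add: norm_minus_commute divide_simps)
  then show ?thesis
    by (simp add: scaled_body_def ball_def dist_norm del: scaleR_diff_right)
qed

definition outer_radius :: "'a::euclidean_space set \<Rightarrow> real" where
  "outer_radius K = (SUP x\<in>frontier K. norm x)"

text \<open>The supremum is attained, so \<^const>\<open>outer_radius\<close> is a maximum.\<close>

lemma outer_radius_max:
  fixes K :: "'a::euclidean_space set"
  assumes "standard_body K"
  shows "\<exists>x\<in>frontier K. norm x = outer_radius K \<and> (\<forall>y\<in>frontier K. norm y \<le> norm x)"
proof -
  have bd: "bounded K"
    using assms by (simp add: standard_body_def)
  have "0 \<in> K"
    using assms by (simp add: standard_body_def starshaped_wrt_def)
  then have ne: "K \<noteq> {}" by blast
  have "K \<noteq> UNIV"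
    using bd not_bounded_UNIV by blast
  with ne have "frontier K \<noteq> {}"
    using frontier_eq_empty by blast
  moreover have "compact (frontier K)"
    using bd compact_frontier_bounded by blast
  ultimately obtain x where x: "x \<in> frontier K" "\<forall>y\<in>frontier K. norm y \<le> norm x"
    using continuous_attains_sup[of "frontier K" norm] continuous_on_norm_id by blast
  have "outer_radius K = norm x"
    unfolding outer_radius_def
    by (rule cSup_eq_maximum) (use x in auto)
  with x show ?thesis by auto
qed


subsection \<open>Capacitary inradii\<close>

definition rel_cap_inradius ::
    "real \<Rightarrow> real \<Rightarrow> 'a::euclidean_space set \<Rightarrow> 'a set \<Rightarrow> ennreal" where
  "rel_cap_inradius p \<gamma> \<Omega> K =
     (SUP r \<in> {r. r > 0 \<and> (\<exists>x0.
          rel_cap p (closure (scaled_body K r x0) - \<Omega>) (scaled_body K (2 * r) x0)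
          \<le> ennreal \<gamma> * rel_cap p (closure (scaled_body K r x0)) (scaled_body K (2 * r) x0))}.
        ennreal r)"

definition cap_inradius :: "real \<Rightarrow> real \<Rightarrow> 'a::euclidean_space set \<Rightarrow> ennreal" where
  "cap_inradius p \<gamma> \<Omega> =
     (SUP r \<in> {r. r > 0 \<and> (\<exists>x0.
          rel_cap p (closure (ball x0 r) - \<Omega>) (ball x0 (2 * r))
          \<le> ennreal \<gamma> * rel_cap p (closure (ball x0 r)) (ball x0 (2 * r)))}.
        ennreal r)"

lemma cap_inradius_eq_rel: "cap_inradius p \<gamma> \<Omega> = rel_cap_inradius p \<gamma> \<Omega> (ball 0 1)"
  unfolding cap_inradius_def rel_cap_inradius_def
  by (rule arg_cong[where f = Sup], rule image_cong) (auto simp: scaled_body_ball)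

end

theory Submission
  imports Defs "HOL-Computational_Algebra.Polynomial"
begin

text \<open>
  Both inequalities come from one comparison. Call a body of size \<open>r\<close> centred at \<open>x0\<close> good if
  the part of its closure outside \<open>\<Omega>\<close> has capacity at most \<open>\<gamma>\<close> times the capacity of the
  whole closure, both relative to the concentric body of twice the size. If a good body contains
  another one, then the inner one is good with \<open>\<gamma>\<close> replaced by \<open>C * \<gamma>\<close>
  (\<open>negligible_capacity_transfer\<close>). For the first inequality the ball of radius \<open>r\<close> lies in
  the copy of \<open>K\<close> of size \<open>r\<close>; for the second the copy of \<open>K\<close> of size
  \<open>r / outer_radius K\<close> lies in the closed ball of radius \<open>r\<close>.

  The reason for the comparison is that capacity relative to one bounded set controls capacity
  relative to another, for all subsets of a fixed compact set (\<open>rel_cap_change_domain\<close>):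
  multiply an admissible function by a cutoff function, and absorb the zero-order term of the
  product rule with the Poincare inequality (\<open>poincare_inequality\<close>). That inequality also shows
  that the capacity of a set with interior points is positive (\<open>rel_cap_pos\<close>), while a cutoff
  function shows that the capacity of a compact set is finite (\<open>rel_cap_finite\<close>), so that the
  capacities of the two full bodies are comparable.

  The constant \<open>C\<close> is independent of \<open>r\<close> and \<open>x0\<close> because an affine map of ratio \<open>r\<close>
  multiplies every relative capacity by the same power of \<open>r\<close> (\<open>rel_cap_vimage_affine\<close>). As
  \<open>\<Omega>\<close> is an arbitrary set in the comparison, replacing it by its preimage reduces everything to
  the bodies of size 1 centred at the origin (\<open>negligible_in_body_rescale\<close>).
\<close>

section \<open>Closure properties of smooth functions\<close>

lemma Ck_SucI:
  assumes "\<And>x. (f has_derivative D x) (at x)"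
    and "\<And>i. i \<in> Basis \<Longrightarrow> Ck k (\<lambda>x. D x i)"
  shows "Ck (Suc k) f"
proof -
  have "frechet_derivative f (at x) = D x" for x
    using assms(1) frechet_derivative_at by metis
  moreover have "f differentiable_on UNIV"
    using assms(1) by (auto simp: differentiable_on_def differentiable_def)
  ultimately show ?thesis
    using assms(2) by simp
qed

lemma Ck_SucD:
  assumes "Ck (Suc k) f"
  shows "(f has_derivative frechet_derivative f (at x)) (at x)"
    and "i \<in> Basis \<Longrightarrow> Ck k (\<lambda>x. frechet_derivative f (at x) i)"
proof -
  have "f differentiable (at x)"
    using assms by (simp add: differentiable_on_def)
  then show "(f has_derivative frechet_derivative f (at x)) (at x)"
    by (simp only: frechet_derivative_works)
  show "i \<in> Basis \<Longrightarrow> Ck k (\<lambda>x. frechet_derivative f (at x) i)"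
    using assms by simp
qed

lemma Ck_Suc_imp_Ck: "Ck (Suc k) f \<Longrightarrow> Ck k f"
proof (induction k arbitrary: f)
  case 0
  then show ?case
    by (simp add: differentiable_imp_continuous_on)
next
  case (Suc k)
  then show ?case by (metis Ck.simps(2))
qed

lemma Ck_const: "Ck k (\<lambda>x. c)"
proof (induction k arbitrary: c)
  case (Suc k)
  show ?case
    by (rule Ck_SucI[where D = "\<lambda>x h. 0"]) (auto intro: Suc)
qed simp

lemma Ck_add: "Ck k f \<Longrightarrow> Ck k g \<Longrightarrow> Ck k (\<lambda>x. f x + g x)"
proof (induction k arbitrary: f g)
  case 0
  then show ?case by (simp add: continuous_on_add)
next
  case (Suc k)
  show ?case
    by (rule Ck_SucI, rule has_derivative_add[OF Ck_SucD(1)[OF Suc.prems(1)] Ck_SucD(1)[OF Suc.prems(2)]])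
      (intro Suc.IH Ck_SucD(2)[OF Suc.prems(1)] Ck_SucD(2)[OF Suc.prems(2)])
qed

lemma Ck_mult: "Ck k f \<Longrightarrow> Ck k g \<Longrightarrow> Ck k (\<lambda>x. f x * g x)"
proof (induction k arbitrary: f g)
  case 0
  then show ?case by (simp add: continuous_on_mult)
next
  case (Suc k)
  show ?case
    by (rule Ck_SucI, rule has_derivative_mult[OF Ck_SucD(1)[OF Suc.prems(1)] Ck_SucD(1)[OF Suc.prems(2)]])
      (intro Ck_add Suc.IH Ck_SucD(2)[OF Suc.prems(1)] Ck_SucD(2)[OF Suc.prems(2)]
        Ck_Suc_imp_Ck[OF Suc.prems(1)] Ck_Suc_imp_Ck[OF Suc.prems(2)])
qed

lemma Ck_inner_const: "Ck k (\<lambda>x. (x - a) \<bullet> b)"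
proof (cases k)
  case (Suc j)
  have "((\<lambda>x. (x - a) \<bullet> b) has_derivative (\<lambda>h. h \<bullet> b)) (at x)" for x
    by (auto intro!: derivative_eq_intros)
  then show ?thesis
    unfolding Suc by (rule Ck_SucI) (rule Ck_const)
qed (auto intro!: continuous_intros)

lemma Ck_dist_squared: "Ck k (\<lambda>x. (x - a) \<bullet> (x - a))"
proof (cases k)
  case (Suc j)
  have "((\<lambda>x. (x - a) \<bullet> (x - a)) has_derivative (\<lambda>h. 2 * ((x - a) \<bullet> h))) (at x)" for x
    by (auto intro!: derivative_eq_intros simp: inner_commute)
  then show ?thesis
    unfolding Suc by (rule Ck_SucI) (intro Ck_mult Ck_const Ck_inner_const)
qed (auto intro!: continuous_intros)

lemma Ck_compose_affine: "Ck k f \<Longrightarrow> Ck k (\<lambda>x. f (a + s *\<^sub>R x))"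
proof (induction k arbitrary: f)
  case 0
  then show ?case
    unfolding Ck.simps
    by (intro continuous_on_compose2[of UNIV f UNIV "\<lambda>x. a + s *\<^sub>R x"] continuous_intros) auto
next
  case (Suc k)
  let ?D = "\<lambda>x. frechet_derivative f (at x)"
  have lin: "linear (?D x)" for x
    using Ck_SucD(1)[OF Suc.prems] has_derivative_linear by blast
  have "((\<lambda>x. a + s *\<^sub>R x) has_derivative (\<lambda>h. s *\<^sub>R h)) (at x)" for x :: 'a
    by (auto intro!: derivative_eq_intros)
  from diff_chain_at[OF this Ck_SucD(1)[OF Suc.prems]]
  have "((\<lambda>x. f (a + s *\<^sub>R x)) has_derivative (\<lambda>h. s * ?D (a + s *\<^sub>R x) h)) (at x)" for x
    by (simp add: o_def linear_cmul[OF lin])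
  then show ?case
    by (rule Ck_SucI) (intro Ck_mult Ck_const Suc.IH Ck_SucD(2)[OF Suc.prems])
qed

text \<open>The chain rule is iterated by letting the outer function range over the sequence
  \<open>h 0, h 1, \<dots>\<close> of its successive derivatives.\<close>

lemma Ck_compose_derivative_sequence:
  assumes "\<And>n t. (h n has_real_derivative h (Suc n) t) (at t)"
  shows "Ck k g \<Longrightarrow> Ck k (\<lambda>x. h n (g x))"
proof (induction k arbitrary: n)
  case 0
  have "continuous_on UNIV (h n)"
    using DERIV_isCont[OF assms] by (intro continuous_at_imp_continuous_on) blast
  with 0 show ?case
    unfolding Ck.simps by (intro continuous_on_compose2[of UNIV "h n" UNIV g]) auto
next
  case (Suc k)
  let ?D = "\<lambda>x. frechet_derivative g (at x)"
  have "((\<lambda>x. h n (g x)) has_derivative (\<lambda>v. h (Suc n) (g x) * ?D x v)) (at x)" for x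
    using diff_chain_at[OF Ck_SucD(1)[OF Suc.prems] assms[THEN has_field_derivative_imp_has_derivative]]
    by (simp add: o_def)
  then show ?case
    by (rule Ck_SucI)
      (intro Ck_mult Suc.IH[OF Ck_Suc_imp_Ck[OF Suc.prems]] Ck_SucD(2)[OF Suc.prems])
qed

lemma smooth_imp_differentiable: "smooth f \<Longrightarrow> f differentiable (at x)"
  unfolding smooth_def
  by (metis Ck.simps(2) UNIV_I at_within_open differentiable_on_def open_UNIV)

lemma smooth_imp_continuous_on: "smooth f \<Longrightarrow> continuous_on A f"
  unfolding smooth_def by (metis Ck.simps(1) continuous_on_subset subset_UNIV)

lemma smooth_imp_continuous_on_grad:
  assumes "smooth f"
  shows "continuous_on A (grad f)"
proof -
  have "continuous_on UNIV (\<lambda>x. frechet_derivative f (at x) i)" if "i \<in> Basis" for i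
    using assms that Ck_SucD(2)[of 0 f] by (auto simp: smooth_def)
  then have "continuous_on UNIV (grad f)"
    unfolding grad_def by (intro continuous_intros)
  then show ?thesis
    using continuous_on_subset by blast
qed


section \<open>Smooth cutoff functions\<close>

text \<open>For \<open>t > 0\<close> the \<open>n\<close>-th derivative of \<open>t \<mapsto> exp (- 1 / t)\<close> is \<open>flat_poly n\<close>
  evaluated at \<open>1 / t\<close>, times \<open>exp (- 1 / t)\<close>; the recursion is the product rule together with
  \<open>(1 / t)' = - (1 / t)\<^sup>2\<close>.\<close>

primrec flat_poly :: "nat \<Rightarrow> real poly" where
  "flat_poly 0 = 1"
| "flat_poly (Suc n) = [:0, 0, 1:] * (flat_poly n - pderiv (flat_poly n))"

definition flat_deriv :: "nat \<Rightarrow> real \<Rightarrow> real" where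
  "flat_deriv n t = (if t \<le> 0 then 0 else poly (flat_poly n) (1 / t) * exp (- (1 / t)))"

lemma tendsto_poly_div_exp: "((\<lambda>x. poly q x / exp x) \<longlongrightarrow> (0::real)) at_top"
proof -
  have "((\<lambda>x. \<Sum>i\<le>degree q. coeff q i * (x ^ i / exp x)) \<longlongrightarrow> (\<Sum>i\<le>degree q. coeff q i * 0)) at_top"
    by (intro tendsto_intros tendsto_power_div_exp_0)
  then show ?thesis
    by (simp add: poly_altdef sum_divide_distrib)
qed

text \<open>At 0 the difference quotient from the right is a polynomial in \<open>1 / t\<close> divided by
  \<open>exp (1 / t)\<close>, which tends to 0.\<close>

lemma flat_deriv_has_derivative:
  "(flat_deriv n has_real_derivative flat_deriv (Suc n) t) (at t)"
proof -
  consider "t < 0" | "t > 0" | "t = 0" by linarith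
  then show ?thesis
  proof cases
    case 1
    have "((\<lambda>_. 0) has_real_derivative flat_deriv (Suc n) t) (at t)"
      using 1 by (simp add: flat_deriv_def)
    then show ?thesis
      by (rule has_field_derivative_transform_within_open[of _ _ _ "{..<0}"])
        (use 1 in \<open>auto simp: flat_deriv_def\<close>)
  next
    case 2
    let ?P = "flat_poly n"
    have "((\<lambda>s. poly ?P (1 / s) * exp (- (1 / s))) has_real_derivative flat_deriv (Suc n) t) (at t)"
      using 2
      by (auto intro!: derivative_eq_intros DERIV_chain'[OF _ poly_DERIV]
          simp: flat_deriv_def power2_eq_square field_simps)
    then show ?thesis
      by (rule has_field_derivative_transform_within_open[of _ _ _ "{0<..}"])
        (use 2 in \<open>auto simp: flat_deriv_def\<close>)
  next
    case 3
    have "((\<lambda>h. flat_deriv n h / h) \<longlongrightarrow> 0) (at 0)"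
      proof (rule filterlim_split_at)
      show "((\<lambda>h. flat_deriv n h / h) \<longlongrightarrow> 0) (at_left 0)"
        by (rule Lim_transform_eventually[OF tendsto_const])
          (auto simp: flat_deriv_def eventually_at_filter)
      have "((\<lambda>h. poly ([:0, 1:] * flat_poly n) (inverse h) / exp (inverse h)) \<longlongrightarrow> 0) (at_right 0)"
        by (rule filterlim_compose[OF tendsto_poly_div_exp filterlim_inverse_at_top_right])
      then show "((\<lambda>h. flat_deriv n h / h) \<longlongrightarrow> 0) (at_right 0)"
        by (rule Lim_transform_eventually)
          (auto simp: flat_deriv_def eventually_at_filter exp_minus field_simps)
    qed
    then show ?thesis
      unfolding 3 DERIV_def by (simp add: flat_deriv_def)
  qed
qed

definition bump :: "'a::euclidean_space \<Rightarrow> real \<Rightarrow> 'a \<Rightarrow> real" where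
  "bump a e x = flat_deriv 0 (e\<^sup>2 - (x - a) \<bullet> (x - a))"

lemma bump_nonneg: "bump a e x \<ge> 0"
  by (simp add: bump_def flat_deriv_def)

lemma bump_pos_iff:
  assumes "e > 0"
  shows "bump a e x > 0 \<longleftrightarrow> x \<in> ball a e"
proof -
  have "bump a e x > 0 \<longleftrightarrow> (norm (x - a))\<^sup>2 < e\<^sup>2"
    by (auto simp: bump_def flat_deriv_def power2_norm_eq_inner)
  also have "\<dots> \<longleftrightarrow> norm (x - a) < e"
    using assms power_mono_iff[of e "norm (x - a)" 2] by (simp flip: not_le)
  finally show ?thesis
    by (simp add: dist_norm norm_minus_commute)
qed

lemma smooth_bump: "smooth (bump a e)"
proof -
  have "Ck k (\<lambda>x. e\<^sup>2 + (- 1) * ((x - a) \<bullet> (x - a)))" for k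
    by (intro Ck_add Ck_mult Ck_const Ck_dist_squared)
  then have "Ck k (\<lambda>x. flat_deriv 0 (e\<^sup>2 + (- 1) * ((x - a) \<bullet> (x - a))))" for k
    by (rule Ck_compose_derivative_sequence[where h = flat_deriv, OF flat_deriv_has_derivative])
  moreover have "bump a e = (\<lambda>x. flat_deriv 0 (e\<^sup>2 + (- 1) * ((x - a) \<bullet> (x - a))))"
    by (rule ext) (simp only: bump_def mult_minus1 add_uminus_conv_diff)
  ultimately show ?thesis
    by (simp only: smooth_def) simp
qed

lemma bump_in_test_functions:
  assumes "e > 0" "cball a e \<subseteq> F"
  shows "bump a e \<in> test_functions F"
proof -
  have "{x. bump a e x \<noteq> 0} = ball a e"
    using bump_pos_iff[OF assms(1), of a] bump_nonneg[of a e]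
    by (auto simp: set_eq_iff less_le)
  then show ?thesis
    using assms smooth_bump by (auto simp: test_functions_def closure_ball)
qed

lemma test_functionsD:
  assumes "f \<in> test_functions F"
  shows "smooth f" "compact (closure {x. f x \<noteq> 0})" "closure {x. f x \<noteq> 0} \<subseteq> F"
proof -
  have "smooth f \<and> compact (closure {x. f x \<noteq> 0}) \<and> closure {x. f x \<noteq> 0} \<subseteq> F"
    using assms unfolding test_functions_def mem_Collect_eq .
  then show "smooth f" "compact (closure {x. f x \<noteq> 0})" "closure {x. f x \<noteq> 0} \<subseteq> F"
    by blast+
qed

lemma test_functions_if_support_subset:
  assumes "smooth g" "f \<in> test_functions F" "{x. g x \<noteq> 0} \<subseteq> {x. f x \<noteq> 0}"
  shows "g \<in> test_functions F"
proof -
  have sub: "closure {x. g x \<noteq> 0} \<subseteq> closure {x. f x \<noteq> 0}"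
    using assms(3) by (rule closure_mono)
  then have "compact (closure {x. g x \<noteq> 0})"
    using test_functionsD(2)[OF assms(2)] by (metis closed_closure compact_Int_closed inf.absorb_iff2)
  with assms(1) sub test_functionsD(3)[OF assms(2)] show ?thesis
    unfolding test_functions_def mem_Collect_eq by (intro conjI order_trans[OF sub])
qed

lemma test_functions_mult_right:
  assumes "smooth g" "f \<in> test_functions F"
  shows "(\<lambda>x. g x * f x) \<in> test_functions F"
proof (rule test_functions_if_support_subset[OF _ assms(2)])
  show "smooth (\<lambda>x. g x * f x)"
    using assms(1) test_functionsD(1)[OF assms(2)] unfolding smooth_def by (blast intro: Ck_mult)
qed auto

lemma zero_in_test_functions: "(\<lambda>x. 0) \<in> test_functions F"
  by (simp add: test_functions_def smooth_def Ck_const)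

lemma test_functions_add:
  assumes "f \<in> test_functions F" "g \<in> test_functions F"
  shows "(\<lambda>x. f x + g x) \<in> test_functions F"
proof -
  let ?S = "closure {x. f x \<noteq> 0} \<union> closure {x. g x \<noteq> 0}"
  have S: "compact ?S" "?S \<subseteq> F"
    using assms[THEN test_functionsD(2)] assms[THEN test_functionsD(3)]
    by (simp_all only: compact_Un Un_least)
  have "{x. f x + g x \<noteq> 0} \<subseteq> {x. f x \<noteq> 0} \<union> {x. g x \<noteq> 0}"
    by auto
  also have "\<dots> \<subseteq> ?S"
    by (intro Un_mono closure_subset)
  finally have sub: "closure {x. f x + g x \<noteq> 0} \<subseteq> ?S"
    using S(1) by (intro closure_minimal compact_imp_closed)
  have "compact (closure {x. f x + g x \<noteq> 0})"
    using compact_Int_closed[OF S(1) closed_closure[of "{x. f x + g x \<noteq> 0}"]]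
    by (simp only: Int_absorb1[OF sub])
  moreover have "smooth (\<lambda>x. f x + g x)"
    using assms[THEN test_functionsD(1)] unfolding smooth_def by (blast intro: Ck_add)
  ultimately show ?thesis
    using order_trans[OF sub S(2)] by (simp only: test_functions_def mem_Collect_eq simp_thms)
qed

lemma test_functions_sum:
  assumes "\<And>i. i \<in> I \<Longrightarrow> f i \<in> test_functions F"
  shows "(\<lambda>x. \<Sum>i\<in>I. f i x) \<in> test_functions F"
  using assms
  by (induction I rule: infinite_finite_induct) (auto intro: zero_in_test_functions test_functions_add)

text \<open>Finitely many bumps are positive on all of \<open>S\<close>; by compactness their sum is bounded
  below there, and dividing by the lower bound makes it at least 1.\<close>

lemma smooth_cutoff_exists:
  assumes "compact S" "open F" "S \<subseteq> F"
  obtains \<eta> where "\<eta> \<in> test_functions F" "\<And>x. x \<in> S \<Longrightarrow> 1 \<le> \<eta> x"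
proof (cases "S = {}")
  case True
  then show ?thesis using that zero_in_test_functions by blast
next
  case False
  have "\<exists>e>0. cball x e \<subseteq> F" if "x \<in> S" for x
    using assms that open_contains_cball by blast
  then obtain e where e: "\<And>x. x \<in> S \<Longrightarrow> e x > 0 \<and> cball x (e x) \<subseteq> F"
    by metis
  have "S \<subseteq> (\<Union>x\<in>S. ball x (e x))"
    using e by force
  then obtain C where C: "C \<subseteq> S" "finite C" "S \<subseteq> (\<Union>x\<in>C. ball x (e x))"
    by (rule compactE_image[OF assms(1) open_ball])
  define \<zeta> where "\<zeta> y = (\<Sum>x\<in>C. bump x (e x) y)" for y
  have test: "\<zeta> \<in> test_functions F"
    unfolding \<zeta>_def[abs_def] using C(1) e by (intro test_functions_sum bump_in_test_functions) auto
  have pos: "\<zeta> y > 0" if "y \<in> S" for y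
  proof -
    obtain x where x: "x \<in> C" "y \<in> ball x (e x)"
      using C(3) \<open>y \<in> S\<close> by blast
    then have "bump x (e x) y > 0"
      using C(1) e bump_pos_iff by blast
    with x(1) C(2) show ?thesis
      unfolding \<zeta>_def by (intro sum_pos2[of _ x]) (auto simp: bump_nonneg)
  qed
  have "continuous_on S \<zeta>"
    by (rule smooth_imp_continuous_on[OF test_functionsD(1)[OF test]])
  then obtain z where z: "z \<in> S" "\<And>y. y \<in> S \<Longrightarrow> \<zeta> z \<le> \<zeta> y"
    using continuous_attains_inf[OF assms(1) False] by blast
  show ?thesis
  proof (rule that)
    show "(\<lambda>x. 1 / \<zeta> z * \<zeta> x) \<in> test_functions F"
      by (rule test_functions_mult_right[OF _ test]) (simp add: smooth_def Ck_const)
    show "1 \<le> 1 / \<zeta> z * \<zeta> x" if "x \<in> S" for x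
      using z(2)[OF that] pos[OF z(1)] by simp
  qed
qed


section \<open>The Poincare inequality\<close>

definition energy :: "real \<Rightarrow> ('a::euclidean_space \<Rightarrow> real) \<Rightarrow> ennreal" where
  "energy p f = (\<integral>\<^sup>+x. ennreal (norm (grad f x) powr p) \<partial>lborel)"

lemma test_functions_eq_0: "f \<in> test_functions E \<Longrightarrow> x \<notin> E \<Longrightarrow> f x = 0"
  using test_functionsD(3)[of f E] closure_subset[of "{x. f x \<noteq> 0}"] by blast

lemma grad_eq:
  assumes "\<And>h. D h = h \<bullet> v" "(f has_derivative D) (at x)"
  shows "grad f x = v"
proof -
  have "frechet_derivative f (at x) = D"
    using assms(2) frechet_derivative_at by metis
  then show ?thesis
    by (simp add: grad_def assms(1) inner_commute[of _ v] euclidean_representation)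
qed

lemma grad_eq_0_outside_support:
  assumes "x \<notin> closure {x. f x \<noteq> 0}"
  shows "grad f x = 0"
proof (rule grad_eq)
  have "((\<lambda>_. 0) has_derivative (\<lambda>_. 0)) (at x)"
    by simp
  then show "(f has_derivative (\<lambda>_. 0)) (at x)"
  proof (rule has_derivative_transform_within_open)
    show "open (- closure {x. f x \<noteq> 0})" "x \<in> - closure {x. f x \<noteq> 0}"
      using assms by auto
    show "0 = f y" if "y \<in> - closure {x. f x \<noteq> 0}" for y
    proof -
      have "f y = 0"
        using that closure_subset[of "{x. f x \<noteq> 0}"] by blast
      then show ?thesis by simp
    qed
  qed
qed simp

lemma energy_eq_set_nn_integral:
  assumes "f \<in> test_functions E"
  shows "(\<integral>\<^sup>+x\<in>E. ennreal (norm (grad f x) powr p) \<partial>lborel) = energy p f"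
  unfolding energy_def
proof (rule nn_integral_cong)
  fix x :: 'a
  have "grad f x = 0" if "x \<notin> E"
    using that test_functionsD(3)[OF assms] by (intro grad_eq_0_outside_support) blast
  then show "ennreal (norm (grad f x) powr p) * indicator E x = ennreal (norm (grad f x) powr p)"
    by (cases "x \<in> E") auto
qed

lemma rel_cap_eq_INF_energy:
  "rel_cap p S E = (INF f \<in> {f \<in> test_functions E. \<forall>x\<in>S. 1 \<le> f x}. energy p f)"
  unfolding rel_cap_def by (rule INF_cong) (auto simp: energy_eq_set_nn_integral)

lemma smooth_has_derivative_grad:
  "smooth f \<Longrightarrow> (f has_derivative (\<lambda>h. h \<bullet> grad f x)) (at x)"
  using GDERIV_grad[OF smooth_imp_differentiable] by (simp add: gderiv_def)

lemma borel_measurable_norm_grad_powr: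
  assumes "smooth f"
  shows "(\<lambda>x. ennreal (norm (grad f x) powr p)) \<in> borel_measurable borel"
proof -
  have "grad f \<in> borel_measurable borel"
    by (rule borel_measurable_continuous_onI[OF smooth_imp_continuous_on_grad[OF assms]])
  then show ?thesis by measurable
qed

lemma nn_integral_lborel_affine:
  fixes f :: "'a::euclidean_space \<Rightarrow> ennreal"
  assumes [measurable]: "f \<in> borel_measurable borel" and "c \<noteq> 0"
  shows "(\<integral>\<^sup>+x. f x \<partial>lborel) = ennreal (\<bar>c\<bar> ^ DIM('a)) * (\<integral>\<^sup>+x. f (t + c *\<^sub>R x) \<partial>lborel)"
  by (subst lborel_affine[OF assms(2), of t])
    (simp add: nn_integral_density nn_integral_distr nn_integral_cmult)

lemma powr_above_tangent:
  fixes m y p :: real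
  assumes "1 \<le> p" "0 < m" "0 \<le> y"
  shows "m powr p + p * m powr (p - 1) * (y - m) \<le> y powr p"
proof (cases "y = 0")
  case True
  have "m powr p = m powr (p - 1) * m"
    using assms(2) by (simp add: powr_diff)
  then have "m powr p + p * m powr (p - 1) * (y - m) = (1 - p) * m powr p"
    using True by (simp add: algebra_simps)
  also have "\<dots> \<le> 0"
    using assms(1) by (simp add: mult_nonpos_nonneg)
  finally show ?thesis
    using True by simp
next
  case False
  have "((\<lambda>x. x powr p) has_real_derivative p * m powr (p - 1)) (at m within {0<..})"
    using assms(2) by (intro has_field_derivative_at_within[OF has_real_derivative_powr])
  then have "y powr p - m powr p \<ge> p * m powr (p - 1) * (y - m)"
    using assms False
    by (intro convex_on_imp_above_tangent[OF powr_convex[OF assms(1)]]) (auto simp: interior_open)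
  then show ?thesis by simp
qed

text \<open>By the fundamental theorem of calculus the average of \<open>\<bar>u'\<bar>\<close> over \<open>[0, L]\<close> is at least
  \<open>m = \<bar>u 0\<bar> / L\<close>. Integrating the tangent line of \<open>y powr p\<close> at \<open>m\<close>, evaluated at
  \<open>y = \<bar>u' t\<bar>\<close>, turns this into Jensen's inequality.\<close>

lemma abs_powr_le_integral_deriv:
  fixes u :: "real \<Rightarrow> real"
  assumes p: "1 \<le> p" and L: "0 < L"
    and deriv: "\<And>t. (u has_real_derivative u' t) (at t)"
    and cont: "continuous_on UNIV u'"
    and uL: "u L = 0"
  shows "ennreal (\<bar>u 0\<bar> powr p)
    \<le> ennreal (L powr (p - 1)) * (\<integral>\<^sup>+t. ennreal (\<bar>u' t\<bar> powr p) * indicator {0..L} t \<partial>lborel)"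
proof (cases "u 0 = 0")
  case False
  define m where "m = \<bar>u 0\<bar> / L"
  have m: "m > 0"
    using False L by (simp add: m_def)
  have cont': "continuous_on {0..L} u'"
    using cont continuous_on_subset by blast
  have int1: "(\<lambda>t. \<bar>u' t\<bar>) integrable_on {0..L}"
    by (intro integrable_continuous_real continuous_intros cont')
  have contp: "continuous_on A (\<lambda>t. \<bar>u' t\<bar> powr p)" for A
    using p continuous_on_subset[OF cont, of A]
    by (intro continuous_on_powr' continuous_intros) auto
  have intp: "(\<lambda>t. \<bar>u' t\<bar> powr p) integrable_on {0..L}"
    by (intro integrable_continuous_real contp)
  have "(u' has_integral (u L - u 0)) {0..L}"
    using L deriv
    by (intro fundamental_theorem_of_calculus)
      (auto simp flip: has_real_derivative_iff_has_vector_derivative intro: has_field_derivative_at_within)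
  then have "integral {0..L} u' = - u 0" "u' integrable_on {0..L}"
    using uL by (auto simp: has_integral_iff)
  then have FTC: "\<bar>u 0\<bar> \<le> integral {0..L} (\<lambda>t. \<bar>u' t\<bar>)"
    using integral_norm_bound_integral[of u' "{0..L}" "\<lambda>t. \<bar>u' t\<bar>"] int1 by simp
  let ?T = "\<lambda>t. m powr p + p * m powr (p - 1) * (\<bar>u' t\<bar> - m)"
  have "integral {0..L} ?T = L * m powr p + p * m powr (p - 1) * (integral {0..L} (\<lambda>t. \<bar>u' t\<bar>) - L * m)"
  proof -
    have "(?T has_integral
        (L * m powr p + p * m powr (p - 1) * (integral {0..L} (\<lambda>t. \<bar>u' t\<bar>) - L * m))) {0..L}"
      using has_integral_const_real[of "m powr p" 0 L] has_integral_const_real[of m 0 L] L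
      by (intro has_integral_add has_integral_mult_right has_integral_diff integrable_integral int1) auto
    then show ?thesis by (rule integral_unique)
  qed
  moreover have "L * m = \<bar>u 0\<bar>"
    using L by (simp add: m_def)
  ultimately have "L * m powr p \<le> integral {0..L} ?T"
    using FTC p by (simp add: mult_nonneg_nonneg)
  also have "\<dots> \<le> integral {0..L} (\<lambda>t. \<bar>u' t\<bar> powr p)"
    using powr_above_tangent[OF p m]
    by (intro integral_le intp integrable_continuous_real continuous_intros cont') auto
  finally have I: "L * m powr p \<le> integral {0..L} (\<lambda>t. \<bar>u' t\<bar> powr p)" .
  have "((\<lambda>t. if t \<in> {0..L} then \<bar>u' t\<bar> powr p else 0) has_integral
      integral {0..L} (\<lambda>t. \<bar>u' t\<bar> powr p)) UNIV"
    using integrable_integral[OF intp] by (simp only: has_integral_restrict_UNIV)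
  moreover have "(\<lambda>t. if t \<in> {0..L} then \<bar>u' t\<bar> powr p else 0) \<in> borel_measurable borel"
    using borel_measurable_continuous_onI[OF contp] by measurable
  ultimately have nn: "(\<integral>\<^sup>+t. ennreal (if t \<in> {0..L} then \<bar>u' t\<bar> powr p else 0) \<partial>lborel)
      = ennreal (integral {0..L} (\<lambda>t. \<bar>u' t\<bar> powr p))"
    by (intro nn_integral_has_integral_lborel) auto
  have "(\<integral>\<^sup>+t. ennreal (if t \<in> {0..L} then \<bar>u' t\<bar> powr p else 0) \<partial>lborel)
      = (\<integral>\<^sup>+t. ennreal (\<bar>u' t\<bar> powr p) * indicator {0..L} t \<partial>lborel)"
    by (intro nn_integral_cong) (auto simp: indicator_def)
  moreover have "\<bar>u 0\<bar> powr p \<le> L powr (p - 1) * integral {0..L} (\<lambda>t. \<bar>u' t\<bar> powr p)"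
  proof -
    have "\<bar>u 0\<bar> powr p = L powr (p - 1) * (L * m powr p)"
      using L by (simp add: m_def powr_divide powr_diff)
    with I show ?thesis
      by (simp add: mult_left_mono)
  qed
  ultimately show ?thesis
    using nn by (simp add: ennreal_leI flip: ennreal_mult')
qed simp

text \<open>Since \<open>E\<close> has diameter less than \<open>L\<close>, translating a point of \<open>E\<close> by \<open>L\<close> in a coordinate
  direction leads out of \<open>E\<close>, where \<open>f\<close> vanishes. So the one-dimensional estimate applies on
  every such segment, and by Tonelli and translation invariance integrating over all starting
  points costs another factor \<open>L\<close>.\<close>

lemma poincare_inequality:
  fixes f :: "'a::euclidean_space \<Rightarrow> real"
  assumes p: "1 \<le> p" and L: "0 < L"
    and diam: "\<And>x y. x \<in> E \<Longrightarrow> y \<in> E \<Longrightarrow> dist x y < L"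
    and f: "f \<in> test_functions E"
  shows "(\<integral>\<^sup>+x. ennreal (\<bar>f x\<bar> powr p) \<partial>lborel) \<le> ennreal (L powr p) * energy p f"
proof -
  obtain e :: 'a where e: "e \<in> Basis"
    using nonempty_Basis by blast
  have sm: "smooth f"
    using f by (rule test_functionsD)
  define g where "g x = ennreal (norm (grad f x) powr p)" for x
  have g [measurable]: "g \<in> borel_measurable borel"
    unfolding g_def[abs_def] using sm by (rule borel_measurable_norm_grad_powr)
  have pointwise: "ennreal (\<bar>f x\<bar> powr p)
      \<le> ennreal (L powr (p - 1)) * (\<integral>\<^sup>+t. g (x + t *\<^sub>R e) * indicator {0..L} t \<partial>lborel)" for x
  proof (cases "f x = 0")
    case False
    then have "x \<in> E"
      using test_functions_eq_0[OF f] by blast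
    then have "x + L *\<^sub>R e \<notin> E"
      using diam[of x "x + L *\<^sub>R e"] e L by (auto simp: dist_norm)
    then have fL: "f (x + L *\<^sub>R e) = 0"
      by (rule test_functions_eq_0[OF f])
    let ?u' = "\<lambda>t. e \<bullet> grad f (x + t *\<^sub>R e)"
    have "((\<lambda>t. f (x + t *\<^sub>R e)) has_real_derivative ?u' t) (at t)" for t
    proof -
      have "((\<lambda>t. x + t *\<^sub>R e) has_derivative (\<lambda>h. h *\<^sub>R e)) (at t)"
        by (auto intro!: derivative_eq_intros)
      from diff_chain_at[OF this smooth_has_derivative_grad[OF sm]] show ?thesis
        by (simp add: has_field_derivative_def o_def mult.commute[of "e \<bullet> _"] mult_commute_abs)
    qed
    moreover have "continuous_on UNIV ?u'"
      by (intro continuous_on_inner continuous_intros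
          continuous_on_compose2[OF smooth_imp_continuous_on_grad[OF sm, of UNIV]]) auto
    ultimately have "ennreal (\<bar>f (x + 0 *\<^sub>R e)\<bar> powr p)
      \<le> ennreal (L powr (p - 1)) * (\<integral>\<^sup>+t. ennreal (\<bar>?u' t\<bar> powr p) * indicator {0..L} t \<partial>lborel)"
      by (rule abs_powr_le_integral_deriv[where u = "\<lambda>t. f (x + t *\<^sub>R e)", OF p L _ _ fL])
    also have "\<dots> \<le> ennreal (L powr (p - 1)) * (\<integral>\<^sup>+t. g (x + t *\<^sub>R e) * indicator {0..L} t \<partial>lborel)"
    proof (intro mult_left_mono nn_integral_mono mult_right_mono)
      fix t
      have "\<bar>?u' t\<bar> \<le> norm (grad f (x + t *\<^sub>R e))"
        using Basis_le_norm[OF e] by (subst inner_commute)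
      then show "ennreal (\<bar>?u' t\<bar> powr p) \<le> g (x + t *\<^sub>R e)"
        unfolding g_def using p by (intro ennreal_leI powr_mono2) auto
    qed auto
    finally show ?thesis by simp
  qed (use p in simp)
  have "(\<integral>\<^sup>+x. ennreal (\<bar>f x\<bar> powr p) \<partial>lborel)
      \<le> (\<integral>\<^sup>+x. ennreal (L powr (p - 1)) * (\<integral>\<^sup>+t. g (x + t *\<^sub>R e) * indicator {0..L} t \<partial>lborel) \<partial>lborel)"
    by (intro nn_integral_mono pointwise)
  also have "\<dots> = ennreal (L powr (p - 1)) *
      (\<integral>\<^sup>+x. (\<integral>\<^sup>+t. g (x + t *\<^sub>R e) * indicator {0..L} t \<partial>lborel) \<partial>lborel)"
    by (rule nn_integral_cmult) measurable
  also have "(\<integral>\<^sup>+x. (\<integral>\<^sup>+t. g (x + t *\<^sub>R e) * indicator {0..L} t \<partial>lborel) \<partial>lborel)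
      = (\<integral>\<^sup>+t. (\<integral>\<^sup>+x. g (x + t *\<^sub>R e) * indicator {0..L} t \<partial>lborel) \<partial>lborel)"
    by (rule lborel_pair.Fubini') measurable
  also have "\<dots> = (\<integral>\<^sup>+t. energy p f * indicator {0..L} t \<partial>lborel)"
  proof (rule nn_integral_cong)
    fix t :: real
    have "(\<integral>\<^sup>+x. g (x + t *\<^sub>R e) \<partial>lborel) = energy p f"
      using nn_integral_lborel_affine[OF g, of 1 "t *\<^sub>R e"]
      by (simp add: add.commute energy_def g_def)
    then show "(\<integral>\<^sup>+x. g (x + t *\<^sub>R e) * indicator {0..L} t \<partial>lborel) = energy p f * indicator {0..L} t"
      by (simp add: nn_integral_multc)
  qed
  also have "\<dots> = energy p f * ennreal L"
    using L by (simp add: nn_integral_cmult)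
  finally show ?thesis
    using L by (simp add: mult.left_commute[of _ "energy p f"] mult.commute[of _ "energy p f"]
        powr_diff flip: ennreal_mult')
qed


section \<open>Comparing relative capacities\<close>

lemma rel_cap_le_energy:
  "f \<in> test_functions E \<Longrightarrow> (\<And>x. x \<in> S \<Longrightarrow> 1 \<le> f x) \<Longrightarrow> rel_cap p S E \<le> energy p f"
  unfolding rel_cap_eq_INF_energy by (rule INF_lower) auto

lemma rel_cap_greatest:
  "(\<And>f. f \<in> test_functions E \<Longrightarrow> (\<And>x. x \<in> S \<Longrightarrow> 1 \<le> f x) \<Longrightarrow> a \<le> energy p f) \<Longrightarrow> a \<le> rel_cap p S E"
  unfolding rel_cap_eq_INF_energy by (rule INF_greatest) auto

text \<open>The positive finite factor can be moved across the infimum that defines the capacity.\<close>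

lemma le_mult_rel_capI:
  assumes "0 < c"
    and "\<And>f. f \<in> test_functions E \<Longrightarrow> (\<And>x. x \<in> S \<Longrightarrow> 1 \<le> f x) \<Longrightarrow> a \<le> ennreal c * energy p f"
  shows "a \<le> ennreal c * rel_cap p S E"
proof -
  have "ennreal (1 / c) * a \<le> rel_cap p S E"
  proof (rule rel_cap_greatest)
    fix f assume "f \<in> test_functions E" "\<And>x. x \<in> S \<Longrightarrow> 1 \<le> f x"
    then have "ennreal (1 / c) * a \<le> ennreal (1 / c) * (ennreal c * energy p f)"
      using assms(2) by (intro mult_left_mono) auto
    also have "\<dots> = energy p f"
      using assms(1) by (simp flip: mult.assoc ennreal_mult')
    finally show "ennreal (1 / c) * a \<le> energy p f" .
  qed
  then have "ennreal c * (ennreal (1 / c) * a) \<le> ennreal c * rel_cap p S E"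
    by (rule mult_left_mono) simp
  then show ?thesis
    using assms(1) by (simp flip: mult.assoc ennreal_mult')
qed

lemma rel_cap_mono: "S \<subseteq> S' \<Longrightarrow> rel_cap p S E \<le> rel_cap p S' E"
  by (rule rel_cap_greatest) (auto intro: rel_cap_le_energy)

lemma norm_grad_mult_le:
  assumes "smooth f" "smooth g"
  shows "norm (grad (\<lambda>x. f x * g x) x) \<le> \<bar>f x\<bar> * norm (grad g x) + \<bar>g x\<bar> * norm (grad f x)"
proof -
  have "((\<lambda>x. f x * g x) has_derivative (\<lambda>h. f x * (h \<bullet> grad g x) + h \<bullet> grad f x * g x)) (at x)"
    by (rule has_derivative_mult[OF smooth_has_derivative_grad[OF assms(1)] smooth_has_derivative_grad[OF assms(2)]])
  then have "grad (\<lambda>x. f x * g x) x = f x *\<^sub>R grad g x + g x *\<^sub>R grad f x"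
    by (rule grad_eq[rotated]) (simp add: inner_add_right)
  then show ?thesis
    using norm_triangle_ineq[of "f x *\<^sub>R grad g x" "g x *\<^sub>R grad f x"] by simp
qed

lemma test_function_bounded:
  assumes "f \<in> test_functions F"
  obtains M where "0 < M" "\<And>x. \<bar>f x\<bar> \<le> M" "\<And>x. norm (grad f x) \<le> M"
proof -
  let ?K = "closure {x. f x \<noteq> 0}"
  have "compact (f ` ?K)" "compact (grad f ` ?K)"
    using test_functionsD(1,2)[OF assms]
    by (auto intro: compact_continuous_image smooth_imp_continuous_on smooth_imp_continuous_on_grad)
  then have bd: "bounded (f ` ?K)" "bounded (grad f ` ?K)"
    by (auto intro: compact_imp_bounded)
  obtain A where A: "0 < A" "\<And>x. x \<in> ?K \<Longrightarrow> norm (f x) \<le> A"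
    using bd(1) unfolding bounded_pos by blast
  obtain B where B: "0 < B" "\<And>x. x \<in> ?K \<Longrightarrow> norm (grad f x) \<le> B"
    using bd(2) unfolding bounded_pos by blast
  show ?thesis
  proof (rule that)
    show "0 < max A B"
      using A(1) by simp
    show "\<bar>f x\<bar> \<le> max A B" for x
    proof (cases "x \<in> ?K")
      case True
      then show ?thesis using A(2)[of x] by simp
    next
      case False
      then have "f x = 0"
        using closure_subset[of "{x. f x \<noteq> 0}"] by blast
      then show ?thesis using A(1) by simp
    qed
    show "norm (grad f x) \<le> max A B" for x
    proof (cases "x \<in> ?K")
      case True
      then show ?thesis using B(2)[of x] by simp
    next
      case False
      then show ?thesis using A(1) grad_eq_0_outside_support[of x f] by simp
    qed
  qed
qed

lemma add_powr_le:
  fixes a b p :: real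
  assumes "0 \<le> a" "0 \<le> b" "0 \<le> p"
  shows "(a + b) powr p \<le> 2 powr p * (a powr p + b powr p)"
proof -
  have "(a + b) powr p \<le> (2 * max a b) powr p"
    using assms by (intro powr_mono2) auto
  also have "\<dots> = 2 powr p * max a b powr p"
    using assms by (simp add: powr_mult)
  also have "\<dots> \<le> 2 powr p * (a powr p + b powr p)"
    by (intro mult_left_mono) (auto simp: max_def)
  finally show ?thesis .
qed

lemma bounded_diameter_bound:
  fixes E :: "'a::metric_space set"
  assumes "bounded E"
  obtains L where "0 < L" "\<And>x y. x \<in> E \<Longrightarrow> y \<in> E \<Longrightarrow> dist x y < L"
proof (rule that)
  show "0 < diameter E + 1"
    using diameter_ge_0[OF assms] by simp
  show "dist x y < diameter E + 1" if "x \<in> E" "y \<in> E" for x y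
    using diameter_bounded_bound[OF assms that] by simp
qed

text \<open>Multiplying an admissible function for \<open>E\<close> by a fixed cutoff function for the pair
  \<open>S \<subseteq> F\<close> makes it admissible for \<open>F\<close>. The product rule produces a term with the function
  itself, which the Poincare inequality on \<open>E\<close> absorbs into the energy.\<close>

lemma rel_cap_change_domain:
  fixes E F S :: "'a::euclidean_space set"
  assumes p: "1 \<le> p" and "bounded E" "compact S" "open F" "S \<subseteq> F"
  obtains C where "0 < C" "\<And>\<Sigma>. \<Sigma> \<subseteq> S \<Longrightarrow> rel_cap p \<Sigma> F \<le> ennreal C * rel_cap p \<Sigma> E"
proof -
  obtain \<eta> where \<eta>: "\<eta> \<in> test_functions F" "\<And>x. x \<in> S \<Longrightarrow> 1 \<le> \<eta> x"
    using smooth_cutoff_exists[OF assms(3-5)] by blast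
  obtain M where M: "0 < M" "\<And>x. \<bar>\<eta> x\<bar> \<le> M" "\<And>x. norm (grad \<eta> x) \<le> M"
    using test_function_bounded[OF \<eta>(1)] by blast
  obtain L where L: "0 < L" "\<And>x y. x \<in> E \<Longrightarrow> y \<in> E \<Longrightarrow> dist x y < L"
    using bounded_diameter_bound[OF assms(2)] by blast
  \<comment> \<open>\<open>M\<close> bounds the cutoff and its gradient, \<open>2 powr p\<close> splits the power of a sum, and
    \<open>L powr p\<close> is the Poincare constant of \<open>E\<close>.\<close>
  define C where "C = M powr p * 2 powr p * (L powr p + 1)"
  show ?thesis
  proof (rule that)
    show "0 < C"
      using M(1) by (simp add: C_def add_nonneg_pos)
    fix \<Sigma> assume \<Sigma>: "\<Sigma> \<subseteq> S"
    show "rel_cap p \<Sigma> F \<le> ennreal C * rel_cap p \<Sigma> E"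
    proof (rule le_mult_rel_capI[OF \<open>0 < C\<close>])
      fix f assume f: "f \<in> test_functions E" "\<And>x. x \<in> \<Sigma> \<Longrightarrow> 1 \<le> f x"
      have sm: "smooth f" "smooth \<eta>"
        using f(1) \<eta>(1) by (auto intro: test_functionsD(1))
      have [measurable]: "f \<in> borel_measurable borel"
        "(\<lambda>x. ennreal (norm (grad f x) powr p)) \<in> borel_measurable borel"
        using borel_measurable_continuous_onI[OF smooth_imp_continuous_on[OF sm(1)]]
          borel_measurable_norm_grad_powr[OF sm(1)] by auto
      have "rel_cap p \<Sigma> F \<le> energy p (\<lambda>x. f x * \<eta> x)"
      proof (rule rel_cap_le_energy[OF test_functions_mult_right[OF sm(1) \<eta>(1)]])
        show "1 \<le> f x * \<eta> x" if "x \<in> \<Sigma>" for x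
          using mult_mono[of 1 "f x" 1 "\<eta> x"] f(2)[OF that] \<eta>(2)[of x] \<Sigma> that by auto
      qed
      also have "\<dots> \<le> (\<integral>\<^sup>+x. ennreal (M powr p * 2 powr p) *
          (ennreal (\<bar>f x\<bar> powr p) + ennreal (norm (grad f x) powr p)) \<partial>lborel)"
        unfolding energy_def
      proof (rule nn_integral_mono)
        fix x
        have "norm (grad (\<lambda>x. f x * \<eta> x) x) \<le> \<bar>f x\<bar> * norm (grad \<eta> x) + \<bar>\<eta> x\<bar> * norm (grad f x)"
          by (rule norm_grad_mult_le[OF sm])
        also have "\<dots> \<le> \<bar>f x\<bar> * M + M * norm (grad f x)"
          by (intro add_mono mult_left_mono mult_right_mono M) auto
        also have "\<dots> = M * (\<bar>f x\<bar> + norm (grad f x))"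
          by (simp add: algebra_simps)
        finally have "norm (grad (\<lambda>x. f x * \<eta> x) x) powr p \<le> (M * (\<bar>f x\<bar> + norm (grad f x))) powr p"
          using p by (intro powr_mono2) auto
        also have "\<dots> = M powr p * (\<bar>f x\<bar> + norm (grad f x)) powr p"
          using M(1) by (simp add: powr_mult)
        also have "\<dots> \<le> M powr p * (2 powr p * (\<bar>f x\<bar> powr p + norm (grad f x) powr p))"
          using p by (intro mult_left_mono add_powr_le) auto
        finally show "ennreal (norm (grad (\<lambda>x. f x * \<eta> x) x) powr p) \<le> ennreal (M powr p * 2 powr p) *
            (ennreal (\<bar>f x\<bar> powr p) + ennreal (norm (grad f x) powr p))"
          by (simp add: ennreal_leI mult.assoc flip: ennreal_plus ennreal_mult')
      qed
      also have "\<dots> = ennreal (M powr p * 2 powr p) *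
          ((\<integral>\<^sup>+x. ennreal (\<bar>f x\<bar> powr p) \<partial>lborel) + energy p f)"
        unfolding energy_def
        by (subst nn_integral_cmult, measurable)
          (rule arg_cong[where f = "\<lambda>a. _ * a"], rule nn_integral_add, measurable)
      also have "\<dots> \<le> ennreal (M powr p * 2 powr p) * (ennreal (L powr p) * energy p f + energy p f)"
        by (intro mult_left_mono add_right_mono poincare_inequality[OF p L f(1)]) auto
      also have "\<dots> = ennreal (M powr p * 2 powr p) * ((ennreal (L powr p) + ennreal 1) * energy p f)"
        by (simp add: distrib_right)
      also have "\<dots> = ennreal C * energy p f"
        unfolding C_def by (simp add: mult.assoc[symmetric] ennreal_mult')
      finally show "rel_cap p \<Sigma> F \<le> ennreal C * energy p f" .
    qed
  qed
qed

text \<open>An admissible function is at least 1 on a set of positive measure, so the Poincare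
  inequality bounds its energy from below.\<close>

lemma rel_cap_pos:
  fixes S E :: "'a::euclidean_space set"
  assumes p: "1 \<le> p" and "bounded E" and r: "0 < r" "ball a r \<subseteq> S"
  shows "0 < rel_cap p S E"
proof -
  obtain L where L: "0 < L" "\<And>x y. x \<in> E \<Longrightarrow> y \<in> E \<Longrightarrow> dist x y < L"
    using bounded_diameter_bound[OF assms(2)] by blast
  have "emeasure lborel (ball a r) \<le> ennreal (L powr p) * rel_cap p S E"
  proof (rule le_mult_rel_capI)
    fix f assume f: "f \<in> test_functions E" "\<And>x. x \<in> S \<Longrightarrow> 1 \<le> f x"
    have "emeasure lborel (ball a r) = (\<integral>\<^sup>+x. indicator (ball a r) x \<partial>lborel)"
      by simp
    also have "\<dots> \<le> (\<integral>\<^sup>+x. ennreal (\<bar>f x\<bar> powr p) \<partial>lborel)"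
    proof (rule nn_integral_mono)
      fix x
      have "1 \<le> \<bar>f x\<bar> powr p" if "x \<in> ball a r"
        using f(2)[of x] that r(2) p by (intro ge_one_powr_ge_zero) auto
      then show "indicator (ball a r) x \<le> ennreal (\<bar>f x\<bar> powr p)"
        by (auto simp: indicator_def)
    qed
    also have "\<dots> \<le> ennreal (L powr p) * energy p f"
      by (rule poincare_inequality[OF p L f(1)])
    finally show "emeasure lborel (ball a r) \<le> ennreal (L powr p) * energy p f" .
  qed (use L in simp)
  moreover have "0 < emeasure lborel (ball a r)"
    using content_ball_pos[OF r(1), of a] by (auto simp: measure_def enn2real_positive_iff)
  ultimately show ?thesis
    by (metis less_le_not_le mult_zero_right not_gr_zero)
qed

lemma rel_cap_finite:
  fixes S E :: "'a::euclidean_space set"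
  assumes p: "1 \<le> p" and "compact S" "open E" "S \<subseteq> E"
  shows "rel_cap p S E < top"
proof -
  obtain \<eta> where \<eta>: "\<eta> \<in> test_functions E" "\<And>x. x \<in> S \<Longrightarrow> 1 \<le> \<eta> x"
    using smooth_cutoff_exists[OF assms(2-4)] by blast
  obtain M where M: "0 < M" "\<And>x. \<bar>\<eta> x\<bar> \<le> M" "\<And>x. norm (grad \<eta> x) \<le> M"
    using test_function_bounded[OF \<eta>(1)] by blast
  let ?K = "closure {x. \<eta> x \<noteq> 0}"
  have "rel_cap p S E \<le> energy p \<eta>"
    by (rule rel_cap_le_energy[OF \<eta>])
  also have "\<dots> \<le> (\<integral>\<^sup>+x. ennreal (M powr p) * indicator ?K x \<partial>lborel)"
    unfolding energy_def
  proof (rule nn_integral_mono)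
    fix x
    show "ennreal (norm (grad \<eta> x) powr p) \<le> ennreal (M powr p) * indicator ?K x"
      using p M(3)[of x] grad_eq_0_outside_support[of x \<eta>]
      by (cases "x \<in> ?K") (auto intro: ennreal_leI powr_mono2)
  qed
  also have "\<dots> = ennreal (M powr p) * emeasure lborel ?K"
    by (simp add: nn_integral_cmult)
  also have "\<dots> < top"
    using emeasure_compact_finite[OF test_functionsD(2)[OF \<eta>(1)]] by (simp add: ennreal_mult_less_top)
  finally show ?thesis .
qed

text \<open>The constant is the product of two: one for the change of domain from \<open>E\<close> to \<open>E'\<close>, and
  one for the ratio of the capacities of \<open>S\<close> and \<open>S'\<close>.\<close>

lemma negligible_capacity_transfer:
  fixes S E S' E' :: "'a::euclidean_space set"
  assumes p: "1 \<le> p"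
    and E: "compact S" "open E" "bounded E" "S \<subseteq> E"
    and E': "compact S'" "open E'" "bounded E'" "S' \<subseteq> E'"
    and S': "S' \<subseteq> S" "0 < r" "ball a r \<subseteq> S'"
  obtains C where "1 \<le> C"
    "\<And>\<Omega> \<gamma>. 0 \<le> \<gamma> \<Longrightarrow> rel_cap p (S - \<Omega>) E \<le> ennreal \<gamma> * rel_cap p S E
      \<Longrightarrow> rel_cap p (S' - \<Omega>) E' \<le> ennreal (C * \<gamma>) * rel_cap p S' E'"
proof -
  obtain A where A: "0 < A" "\<And>\<Sigma>. \<Sigma> \<subseteq> S' \<Longrightarrow> rel_cap p \<Sigma> E' \<le> ennreal A * rel_cap p \<Sigma> E"
    using rel_cap_change_domain[OF p E(3) E'(1,2,4)] by blast
  obtain s where s: "0 \<le> s" "rel_cap p S E = ennreal s"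
    using rel_cap_finite[OF p E(1,2,4)] by (metis less_top_ennreal)
  obtain s' where s': "0 \<le> s'" "rel_cap p S' E' = ennreal s'"
    using rel_cap_finite[OF p E'(1,2,4)] by (metis less_top_ennreal)
  have "0 < s'"
    using rel_cap_pos[OF p E'(3) S'(2,3)] by (simp add: s'(2))
  define C where "C = max 1 (A * (s / s'))"
  show ?thesis
  proof (rule that)
    show "1 \<le> C"
      by (simp add: C_def)
    fix \<Omega> and \<gamma> :: real
    assume \<gamma>: "0 \<le> \<gamma>" and cap: "rel_cap p (S - \<Omega>) E \<le> ennreal \<gamma> * rel_cap p S E"
    have "rel_cap p (S' - \<Omega>) E' \<le> ennreal A * rel_cap p (S' - \<Omega>) E"
      by (rule A(2)) auto
    also have "\<dots> \<le> ennreal A * rel_cap p (S - \<Omega>) E"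
      using S'(1) by (intro mult_left_mono rel_cap_mono) auto
    also have "\<dots> \<le> ennreal A * (ennreal \<gamma> * ennreal s)"
      using cap by (intro mult_left_mono) (auto simp: s(2))
    also have "\<dots> = ennreal (A * (s / s') * \<gamma> * s')"
      using A(1) \<gamma> s(1) \<open>0 < s'\<close> by (simp add: mult.commute flip: ennreal_mult)
    also have "\<dots> \<le> ennreal (C * \<gamma> * s')"
      using \<gamma> s'(1) by (intro ennreal_leI mult_right_mono) (auto simp: C_def)
    also have "\<dots> = ennreal (C * \<gamma>) * rel_cap p S' E'"
      using s'(1) by (simp add: s'(2) ennreal_mult'')
    finally show "rel_cap p (S' - \<Omega>) E' \<le> ennreal (C * \<gamma>) * rel_cap p S' E'" .
  qed
qed


section \<open>Scaling\<close>

lemma grad_compose_affine: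
  assumes "smooth f"
  shows "grad (\<lambda>x. f (b + s *\<^sub>R x)) x = s *\<^sub>R grad f (b + s *\<^sub>R x)"
proof (rule grad_eq)
  have "((\<lambda>x. b + s *\<^sub>R x) has_derivative (\<lambda>h. s *\<^sub>R h)) (at x)"
    by (auto intro!: derivative_eq_intros)
  from diff_chain_at[OF this smooth_has_derivative_grad[OF assms]]
  show "((\<lambda>x. f (b + s *\<^sub>R x)) has_derivative (\<lambda>h. (s *\<^sub>R h) \<bullet> grad f (b + s *\<^sub>R x))) (at x)"
    by (simp add: o_def)
qed simp

lemma energy_compose_affine:
  fixes f :: "'a::euclidean_space \<Rightarrow> real"
  assumes "smooth f" "0 < s"
  shows "energy p (\<lambda>x. f (b + s *\<^sub>R x)) = ennreal (s powr (p - real DIM('a))) * energy p f"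
proof -
  let ?g = "\<lambda>x. ennreal (norm (grad f x) powr p)"
  have [measurable]: "?g \<in> borel_measurable borel"
    using assms(1) by (rule borel_measurable_norm_grad_powr)
  have "energy p (\<lambda>x. f (b + s *\<^sub>R x)) = (\<integral>\<^sup>+x. ennreal (s powr p) * ?g (b + s *\<^sub>R x) \<partial>lborel)"
    unfolding energy_def using assms(2)
    by (intro nn_integral_cong) (simp add: grad_compose_affine[OF assms(1)] powr_mult ennreal_mult')
  also have "\<dots> = ennreal (s powr p) * (\<integral>\<^sup>+x. ?g (b + s *\<^sub>R x) \<partial>lborel)"
    by (rule nn_integral_cmult) measurable
  finally have 1: "energy p (\<lambda>x. f (b + s *\<^sub>R x)) = ennreal (s powr p) * (\<integral>\<^sup>+x. ?g (b + s *\<^sub>R x) \<partial>lborel)" .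
  have 2: "energy p f = ennreal (s ^ DIM('a)) * (\<integral>\<^sup>+x. ?g (b + s *\<^sub>R x) \<partial>lborel)"
    unfolding energy_def
    using nn_integral_lborel_affine[OF borel_measurable_norm_grad_powr[OF assms(1)], of s p b] assms(2)
    by simp
  have "s powr (p - real DIM('a)) * s ^ DIM('a) = s powr p"
    using assms(2) by (simp add: powr_diff powr_realpow)
  then show ?thesis
    unfolding 1 2 using assms(2) by (simp flip: mult.assoc ennreal_mult')
qed

lemma test_functions_compose_affine:
  fixes f :: "'a::euclidean_space \<Rightarrow> real"
  assumes f: "f \<in> test_functions E" and s: "s \<noteq> 0"
  shows "(\<lambda>x. f (b + s *\<^sub>R x)) \<in> test_functions ((\<lambda>x. b + s *\<^sub>R x) -` E)"
proof -
  let ?T = "\<lambda>x. b + s *\<^sub>R x" and ?K = "closure {x. f x \<noteq> 0}"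
  let ?A = "{x. f (?T x) \<noteq> 0}"
  have eq: "?T -` ?K = (\<lambda>y. (1 / s) *\<^sub>R (y - b)) ` ?K"
  proof
    show "?T -` ?K \<subseteq> (\<lambda>y. (1 / s) *\<^sub>R (y - b)) ` ?K"
    proof
      fix x assume "x \<in> ?T -` ?K"
      moreover have "x = (1 / s) *\<^sub>R (?T x - b)"
        using s by simp
      ultimately show "x \<in> (\<lambda>y. (1 / s) *\<^sub>R (y - b)) ` ?K"
        by blast
    qed
    show "(\<lambda>y. (1 / s) *\<^sub>R (y - b)) ` ?K \<subseteq> ?T -` ?K"
      using s by auto
  qed
  have K: "compact (?T -` ?K)"
    unfolding eq using test_functionsD(2)[OF f]
    by (intro compact_continuous_image continuous_intros) auto
  have "?A \<subseteq> ?T -` ?K"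
    using closure_subset[of "{x. f x \<noteq> 0}"] by blast
  then have sub: "closure ?A \<subseteq> ?T -` ?K"
    by (rule closure_minimal[OF _ compact_imp_closed[OF K]])
  have "compact (closure ?A)"
    using compact_Int_closed[OF K closed_closure[of ?A]] by (simp only: Int_absorb1[OF sub])
  moreover have "closure ?A \<subseteq> ?T -` E"
    using sub test_functionsD(3)[OF f] by blast
  moreover have "smooth (\<lambda>x. f (?T x))"
    using test_functionsD(1)[OF f] unfolding smooth_def by (blast intro: Ck_compose_affine)
  ultimately show ?thesis
    unfolding test_functions_def mem_Collect_eq by blast
qed

lemma rel_cap_vimage_affine_le:
  fixes S E :: "'a::euclidean_space set"
  assumes s: "0 < s"
  shows "rel_cap p ((\<lambda>x. b + s *\<^sub>R x) -` S) ((\<lambda>x. b + s *\<^sub>R x) -` E)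
    \<le> ennreal (s powr (p - real DIM('a))) * rel_cap p S E"
proof (rule le_mult_rel_capI)
  fix f assume f: "f \<in> test_functions E" "\<And>x. x \<in> S \<Longrightarrow> 1 \<le> f x"
  have "rel_cap p ((\<lambda>x. b + s *\<^sub>R x) -` S) ((\<lambda>x. b + s *\<^sub>R x) -` E)
      \<le> energy p (\<lambda>x. f (b + s *\<^sub>R x))"
    using f s by (intro rel_cap_le_energy test_functions_compose_affine) auto
  also have "\<dots> = ennreal (s powr (p - real DIM('a))) * energy p f"
    by (rule energy_compose_affine[OF test_functionsD(1)[OF f(1)] s])
  finally show "rel_cap p ((\<lambda>x. b + s *\<^sub>R x) -` S) ((\<lambda>x. b + s *\<^sub>R x) -` E)
      \<le> ennreal (s powr (p - real DIM('a))) * energy p f" .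
qed (use s in simp)

text \<open>The reverse inequality is the same one for the inverse affine map.\<close>

lemma rel_cap_vimage_affine:
  fixes S E :: "'a::euclidean_space set"
  assumes s: "0 < s"
  shows "rel_cap p ((\<lambda>x. b + s *\<^sub>R x) -` S) ((\<lambda>x. b + s *\<^sub>R x) -` E)
    = ennreal (s powr (p - real DIM('a))) * rel_cap p S E"
    (is "rel_cap p (?T -` S) (?T -` E) = ennreal ?c * _")
proof (rule antisym[OF rel_cap_vimage_affine_le[OF s]])
  let ?T' = "\<lambda>y. - ((1 / s) *\<^sub>R b) + (1 / s) *\<^sub>R y"
  have "?T (?T' y) = y" for y
    using s by (simp add: scaleR_right_diff_distrib)
  then have inv: "?T' -` (?T -` A) = A" for A
    by auto
  have "rel_cap p S E \<le> ennreal ((1 / s) powr (p - real DIM('a))) * rel_cap p (?T -` S) (?T -` E)"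
    using rel_cap_vimage_affine_le[of "1 / s" p "- ((1 / s) *\<^sub>R b)" "?T -` S" "?T -` E"] s
    unfolding inv by simp
  then have "ennreal ?c * rel_cap p S E
      \<le> ennreal ?c * (ennreal ((1 / s) powr (p - real DIM('a))) * rel_cap p (?T -` S) (?T -` E))"
    by (rule mult_left_mono) simp
  also have "\<dots> = rel_cap p (?T -` S) (?T -` E)"
    using s by (simp add: powr_divide flip: mult.assoc ennreal_mult')
  finally show "ennreal ?c * rel_cap p S E \<le> rel_cap p (?T -` S) (?T -` E)" .
qed

lemma scaled_body_eq_vimage:
  "scaled_body K r x0 = (\<lambda>x. - ((1 / r) *\<^sub>R x0) + (1 / r) *\<^sub>R x) -` K"
  by (auto simp: scaled_body_def scaleR_right_diff_distrib divide_inverse_commute)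

lemma scaled_body_scaled_body:
  "scaled_body (scaled_body K s 0) r x0 = scaled_body K (s * r) x0"
  by (simp add: scaled_body_def)

lemma scaled_body_eq_image:
  assumes "r \<noteq> 0"
  shows "scaled_body K r x0 = (\<lambda>x. x0 + r *\<^sub>R x) ` K"
proof
  show "scaled_body K r x0 \<subseteq> (\<lambda>x. x0 + r *\<^sub>R x) ` K"
  proof
    fix x assume "x \<in> scaled_body K r x0"
    moreover have "x = x0 + r *\<^sub>R ((x - x0) /\<^sub>R r)"
      using assms by (simp del: scaleR_diff_right)
    ultimately show "x \<in> (\<lambda>x. x0 + r *\<^sub>R x) ` K"
      unfolding scaled_body_def by blast
  qed
  show "(\<lambda>x. x0 + r *\<^sub>R x) ` K \<subseteq> scaled_body K r x0"
    using assms by (auto simp: scaled_body_def)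
qed

lemma closure_scaled_body:
  assumes "r \<noteq> 0"
  shows "closure (scaled_body K r x0) = scaled_body (closure K) r x0"
proof -
  have "closure ((\<lambda>x. x0 + r *\<^sub>R x) ` K) = closure ((+) x0 ` (*\<^sub>R) r ` K)"
    by (simp add: image_image)
  also have "\<dots> = (+) x0 ` (*\<^sub>R) r ` closure K"
    by (simp only: closure_translation closure_scaleR)
  finally show ?thesis
    by (simp add: scaled_body_eq_image[OF assms] image_image)
qed

definition negligible_in_body :: "real \<Rightarrow> real \<Rightarrow> 'a::euclidean_space set \<Rightarrow> 'a set \<Rightarrow> real \<Rightarrow> 'a \<Rightarrow> bool" where
  "negligible_in_body p \<gamma> \<Omega> K r x0 \<longleftrightarrow>
     rel_cap p (closure (scaled_body K r x0) - \<Omega>) (scaled_body K (2 * r) x0)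
     \<le> ennreal \<gamma> * rel_cap p (closure (scaled_body K r x0)) (scaled_body K (2 * r) x0)"

text \<open>Both sides of the defining inequality scale with the same power of \<open>r\<close>.\<close>

lemma negligible_in_body_rescale:
  assumes r: "0 < r"
  shows "negligible_in_body p \<gamma> \<Omega> K r x0 \<longleftrightarrow>
    rel_cap p (closure K - (\<lambda>x. x0 + r *\<^sub>R x) -` \<Omega>) (scaled_body K 2 0)
    \<le> ennreal \<gamma> * rel_cap p (closure K) (scaled_body K 2 0)"
    (is "_ \<longleftrightarrow> rel_cap p (closure K - ?\<Omega>) ?E \<le> _")
proof -
  let ?T = "\<lambda>x. - ((1 / r) *\<^sub>R x0) + (1 / r) *\<^sub>R x"
  have "x0 + r *\<^sub>R ?T x = x" for x
    using r by (simp add: scaleR_right_diff_distrib)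
  then have inv: "?T -` ?\<Omega> = \<Omega>"
    by auto
  have "r \<noteq> 0"
    using r by simp
  then have cl: "closure (scaled_body K r x0) = ?T -` closure K"
    by (subst closure_scaled_body) (assumption, rule scaled_body_eq_vimage)
  have diff: "?T -` closure K - \<Omega> = ?T -` (closure K - ?\<Omega>)"
    unfolding vimage_Diff inv ..
  have dom: "scaled_body K (2 * r) x0 = ?T -` ?E"
    by (simp only: flip: scaled_body_scaled_body scaled_body_eq_vimage)
  have "0 < 1 / r"
    using r by simp
  note scale = rel_cap_vimage_affine[OF this, of p "- ((1 / r) *\<^sub>R x0)"]
  show ?thesis
    unfolding negligible_in_body_def cl diff dom scale mult.left_commute[of "ennreal \<gamma>"]
    using r by (subst ennreal_mult_le_mult_iff) auto
qed

lemma rel_cap_inradius_eq: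
  "rel_cap_inradius p \<gamma> \<Omega> K = (SUP r \<in> {r. r > 0 \<and> (\<exists>x0. negligible_in_body p \<gamma> \<Omega> K r x0)}. ennreal r)"
  by (simp only: rel_cap_inradius_def negligible_in_body_def)


section \<open>Standard bodies\<close>

lemma ball_subset_standard_body: "standard_body K \<Longrightarrow> ball 0 1 \<subseteq> K"
  by (auto simp: standard_body_def starshaped_wrt_def)

text \<open>If \<open>y \<in> K\<close> is close to \<open>x \<in> closure K\<close> then \<open>x / 2\<close> is the midpoint of \<open>y\<close> and
  of \<open>x - y\<close>, which lies in the unit ball.\<close>

lemma closure_standard_body_subset:
  assumes "standard_body K"
  shows "closure K \<subseteq> scaled_body K 2 0"
proof
  fix x assume "x \<in> closure K"
  then obtain y where y: "y \<in> K" "dist y x < 1"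
    unfolding closure_approachable by (meson zero_less_one)
  then have "x - y \<in> ball 0 1"
    by (simp add: dist_norm norm_minus_commute)
  then have "closed_segment (x - y) y \<subseteq> K"
    using assms y(1) unfolding standard_body_def starshaped_wrt_def by blast
  moreover have "midpoint (x - y) y \<in> closed_segment (x - y) y"
    by simp
  ultimately have "midpoint (x - y) y \<in> K"
    by blast
  then show "x \<in> scaled_body K 2 0"
    by (simp add: scaled_body_def midpoint_def)
qed

lemma one_le_outer_radius:
  assumes "standard_body K"
  shows "1 \<le> outer_radius K"
proof -
  obtain x where x: "x \<in> frontier K" "norm x = outer_radius K"
    using outer_radius_max[OF assms] by blast
  have "x \<notin> K"
    using x(1) assms by (simp add: frontier_def standard_body_def interior_open)
  then have "x \<notin> ball 0 1"
    using ball_subset_standard_body[OF assms] by blast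
  with x(2) show ?thesis by simp
qed

text \<open>The ray from a point of \<open>K\<close> away from the origin leaves the bounded set \<open>K\<close> through a
  frontier point of at least the same norm.\<close>

lemma closure_standard_body_subset_cball:
  assumes "standard_body K"
  shows "closure K \<subseteq> cball 0 (outer_radius K)"
proof (rule closure_minimal)
  show "K \<subseteq> cball 0 (outer_radius K)"
  proof
    fix x assume x: "x \<in> K"
    show "x \<in> cball 0 (outer_radius K)"
    proof (cases "x = 0")
      case True
      then show ?thesis using one_le_outer_radius[OF assms] by simp
    next
      case False
      obtain B where B: "\<And>y. y \<in> K \<Longrightarrow> norm y \<le> B" "0 < B"
        using assms unfolding standard_body_def bounded_pos by blast
      let ?R = "(\<lambda>t. t *\<^sub>R x) ` {1..}"
      have "connected ?R"
        by (intro connected_continuous_image continuous_intros convex_connected) auto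
      moreover have "?R \<inter> K \<noteq> {}"
      proof -
        have "1 *\<^sub>R x \<in> ?R"
          by (intro imageI) simp
        with x show ?thesis by auto
      qed
      moreover have "?R - K \<noteq> {}"
      proof -
        let ?t = "1 + B / norm x"
        have "norm (?t *\<^sub>R x) = norm x + B"
          using False B(2) by (simp add: field_simps abs_of_pos add_pos_pos)
        then have "?t *\<^sub>R x \<notin> K"
          using B(1)[of "?t *\<^sub>R x"] False by auto
        moreover have "1 \<le> ?t"
          using B(2) by simp
        ultimately show ?thesis by blast
      qed
      ultimately have "?R \<inter> frontier K \<noteq> {}"
        by (rule connected_Int_frontier)
      then obtain t where t: "1 \<le> t" "t *\<^sub>R x \<in> frontier K"
        by auto
      have "norm x \<le> norm (t *\<^sub>R x)"
        using t(1) by (simp add: mult_le_cancel_right1)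
      also have "\<dots> \<le> outer_radius K"
        using outer_radius_max[OF assms] t(2) by metis
      finally show ?thesis by simp
    qed
  qed
qed simp


section \<open>Comparison of the capacitary inradii\<close>

theorem proposition3p6:
  fixes p :: real and K :: "(real ^ 'n) set"
  assumes "2 \<le> CARD('n)"
    and "1 \<le> p" and "p \<le> real CARD('n)"
    and "standard_body K"
  shows "\<exists>c d :: real. 0 < c \<and> c \<le> 1 \<and> 1 \<le> d \<and>
    (\<forall>\<Omega> :: (real ^ 'n) set. open \<Omega> \<longrightarrow>
      (\<forall>\<gamma>. 0 < \<gamma> \<and> \<gamma> < 1 \<longrightarrow>
         rel_cap_inradius p (c * \<gamma>) \<Omega> K \<le> cap_inradius p \<gamma> \<Omega>) \<and>
      (\<forall>\<gamma>. 0 < \<gamma> \<and> \<gamma> < 1 / d \<longrightarrow>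
         cap_inradius p \<gamma> \<Omega> \<le> ennreal (outer_radius K) * rel_cap_inradius p (d * \<gamma>) \<Omega> K))"
proof -
  note K = assms(4)
  define R where "R = outer_radius K"
  have R: "1 \<le> R"
    unfolding R_def by (rule one_le_outer_radius[OF K])
  let ?B = "ball 0 1 :: (real ^ 'n) set" and ?BR = "ball 0 R :: (real ^ 'n) set"
  let ?K2 = "scaled_body K 2 0"
  have K': "compact (closure K)" "open ?K2" "bounded ?K2" "closure K \<subseteq> ?K2"
  proof -
    have "open K" "bounded K"
      using K by (auto simp: standard_body_def)
    then show "compact (closure K)" "open ?K2" "bounded ?K2"
      by (auto simp: scaled_body_eq_image intro: open_affinity bounded_translation bounded_scaling)
    show "closure K \<subseteq> ?K2"
      by (rule closure_standard_body_subset[OF K])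
  qed
  have B2: "scaled_body (ball 0 r) 2 0 = (ball 0 (2 * r) :: (real ^ 'n) set)" if "0 < r" for r :: real
    using scaled_body_ball[of r "0 :: real ^ 'n"] scaled_body_ball[of "2 * r" "0 :: real ^ 'n"] that
      scaled_body_scaled_body[of "ball 0 1 :: (real ^ 'n) set" r 2 0]
    by (simp add: mult.commute)
  have B: "compact (closure (ball (0 :: real ^ 'n) r))"
    "open (scaled_body (ball (0 :: real ^ 'n) r) 2 0)"
    "bounded (scaled_body (ball (0 :: real ^ 'n) r) 2 0)"
    "closure (ball (0 :: real ^ 'n) r) \<subseteq> scaled_body (ball 0 r) 2 0"
    if "0 < r" for r :: real
    using that by (auto simp: B2)
  have sub: "closure ?B \<subseteq> closure K" "closure K \<subseteq> closure ?BR" "ball 0 1 \<subseteq> closure ?B"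
    "ball 0 1 \<subseteq> closure K"
    using closure_mono[OF ball_subset_standard_body[OF K]] closure_standard_body_subset_cball[OF K] R
      ball_subset_standard_body[OF K] closure_subset[of K]
    by (auto simp: R_def)
  obtain C where C: "1 \<le> C" "\<And>\<Omega> \<gamma>. 0 \<le> \<gamma> \<Longrightarrow>
      rel_cap p (closure K - \<Omega>) ?K2 \<le> ennreal \<gamma> * rel_cap p (closure K) ?K2 \<Longrightarrow>
      rel_cap p (closure ?B - \<Omega>) (scaled_body ?B 2 0)
        \<le> ennreal (C * \<gamma>) * rel_cap p (closure ?B) (scaled_body ?B 2 0)"
    using negligible_capacity_transfer[OF assms(2) K' B[OF zero_less_one] sub(1) zero_less_one sub(3)]
    by blast
  have "0 < R"
    using R by simp
  obtain D where D: "1 \<le> D" "\<And>\<Omega> \<gamma>. 0 \<le> \<gamma> \<Longrightarrow>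
      rel_cap p (closure ?BR - \<Omega>) (scaled_body ?BR 2 0)
        \<le> ennreal \<gamma> * rel_cap p (closure ?BR) (scaled_body ?BR 2 0) \<Longrightarrow>
      rel_cap p (closure K - \<Omega>) ?K2 \<le> ennreal (D * \<gamma>) * rel_cap p (closure K) ?K2"
    using negligible_capacity_transfer[OF assms(2) B[OF \<open>0 < R\<close>] K' sub(2) zero_less_one sub(4)]
    by blast
  show ?thesis
  proof (rule exI[of _ "1 / C"], rule exI[of _ D], intro conjI allI impI)
    show "0 < 1 / C" "1 / C \<le> 1" "1 \<le> D"
      using C(1) D(1) by auto
    fix \<Omega> :: "(real ^ 'n) set" and \<gamma> :: real
    show "rel_cap_inradius p (1 / C * \<gamma>) \<Omega> K \<le> cap_inradius p \<gamma> \<Omega>" if "0 < \<gamma> \<and> \<gamma> < 1"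
      unfolding cap_inradius_eq_rel rel_cap_inradius_eq
    proof (rule SUP_subset_mono)
      have "negligible_in_body p \<gamma> \<Omega> ?B r x0"
        if "0 < r" "negligible_in_body p (1 / C * \<gamma>) \<Omega> K r x0" for r x0
        using C(2)[of "1 / C * \<gamma>"] that C(1) \<open>0 < \<gamma> \<and> \<gamma> < 1\<close>
        by (simp add: negligible_in_body_rescale)
      then show "{r. 0 < r \<and> (\<exists>x0. negligible_in_body p (1 / C * \<gamma>) \<Omega> K r x0)}
          \<subseteq> {r. 0 < r \<and> (\<exists>x0. negligible_in_body p \<gamma> \<Omega> ?B r x0)}"
        by blast
    qed simp
    show "cap_inradius p \<gamma> \<Omega> \<le> ennreal (outer_radius K) * rel_cap_inradius p (D * \<gamma>) \<Omega> K"
      if \<gamma>: "0 < \<gamma> \<and> \<gamma> < 1 / D"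
      unfolding cap_inradius_eq_rel rel_cap_inradius_eq[of p \<gamma>]
    proof (rule SUP_least)
      fix r assume "r \<in> {r. 0 < r \<and> (\<exists>x0. negligible_in_body p \<gamma> \<Omega> ?B r x0)}"
      then obtain x0 where r: "0 < r" and neg: "negligible_in_body p \<gamma> \<Omega> ?B r x0"
        by blast
      \<comment> \<open>The ball of radius \<open>r\<close> is the size-\<open>s\<close> copy of the ball of radius \<open>R\<close>, whose
        closure contains \<open>K\<close>.\<close>
      define s where "s = r / R"
      have s: "0 < s" "r = R * s"
        using r R by (simp_all add: s_def)
      have "scaled_body ?B (R * t) x0 = scaled_body ?BR t x0" for t
        using scaled_body_ball[of R "0 :: real ^ 'n"] R by (simp flip: scaled_body_scaled_body)
      from this[of s] this[of "2 * s"] have "negligible_in_body p \<gamma> \<Omega> ?BR s x0"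
        using neg unfolding negligible_in_body_def s(2) by (simp add: mult.left_commute)
      then have "negligible_in_body p (D * \<gamma>) \<Omega> K s x0"
        unfolding negligible_in_body_rescale[OF s(1)] using D(2) \<gamma> by simp
      then have "ennreal s \<le> rel_cap_inradius p (D * \<gamma>) \<Omega> K"
        unfolding rel_cap_inradius_eq using s(1) by (intro SUP_upper) auto
      then have "ennreal R * ennreal s \<le> ennreal R * rel_cap_inradius p (D * \<gamma>) \<Omega> K"
        by (rule mult_left_mono) simp
      then show "ennreal r \<le> ennreal (outer_radius K) * rel_cap_inradius p (D * \<gamma>) \<Omega> K"
        using R by (simp add: s(2) ennreal_mult' flip: R_def)
    qed
  qed
qed

end
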